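(* Let $f$ be the (smooth) flux of a system of conservation laws $\partial_t u + \partial_x f(u) = 0$ and let $D$ be the derivative matrix of a (one-dimensional, nodal) summation-by-parts operator with order of accuracy $p\in\mathbb{N}$. If the numerical flux $f^{\mathrm{vol}}$ is smooth, consistent with $f$, and symmetric, then the volume terms $$\mathrm{VOL}_i = \sum_k 2 D_{i,k}\, f^{\mathrm{vol}}(u_i,u_k)$$ are an approximation to $\partial_x f$ of the same order of accuracy as the derivative matrix $D$. Explicitly: for every smooth function $x\mapsto u(x)$ with values in the domain of $f$, with nodal values $u_i=u(x_i)$, one has for every node $x_i$ $$\sum_k 2 D_{i,k}\, f^{\mathrm{vol}}(u_i,u_k) = \partial_x\big(f(u(x))\big)\big|_{x=x_i} + O(h^p)\qquad (h\to 0).$$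
   Context: The conservation law has $n$ unknowns, $u$ takes values in an open set of $\mathbb{R}^n$, and the scalars $D_{i,k}$ multiply vectors in $\mathbb{R}^n$. A numerical flux $f^{\mathrm{vol}}$ is a map $(u_-,u_+)\mapsto f^{\mathrm{vol}}(u_-,u_+)\in\mathbb{R}^n$; it is consistent with $f$ if $f^{\mathrm{vol}}(u,u)=f(u)$ for all $u$, and symmetric if $f^{\mathrm{vol}}(u_i,u_k)=f^{\mathrm{vol}}(u_k,u_i)$. Derivative matrix and order of accuracy: on an element of size $h$, functions are represented by their values at pairwise different nodes $x_i$ (finitely many). The derivative matrix $D$ of an SBP operator with order of accuracy $p$ is exact for polynomials of degree $\le p$: for every polynomial $q$ of degree $\le p$, $\sum_k D_{i,k}\,q(x_k)=q'(x_i)$ for all $i$. Order of accuracy is understood in the usual sense of Taylor expansions: the nodes are $x_i=x_c+h\xi_i$ with fixed reference nodes $\xi_i$ and a fixed point $x_c$, $D=\frac1h\hat D$ with a fixed reference matrix $\hat D$, and $D$ having order $p$ means $\sum_k D_{i,k}\,g(x_k)=g'(x_i)+O(h^p)$ as $h\to0$ for smooth $g$. *)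

theory Defs
  imports
    "HOL-Analysis.Analysis"
    "HOL-Library.Landau_Symbols"
    "HOL-Computational_Algebra.Polynomial"
begin

text \<open>
  \<open>C_on k S f\<close>: \<open>f\<close> is \<open>k\<close> times continuously differentiable on \<open>S\<close>. The domain is always
  finite-dimensional and \<open>S\<close> open, so continuity of all iterated directional derivatives is
  the same as continuity of the iterated Frechet derivatives.
\<close>

primrec C_on :: "nat \<Rightarrow> 'a::euclidean_space set \<Rightarrow> ('a \<Rightarrow> 'b::real_normed_vector) \<Rightarrow> bool" where
  "C_on 0 S f \<longleftrightarrow> continuous_on S f"
| "C_on (Suc k) S f \<longleftrightarrow>
     (\<forall>x\<in>S. f differentiable (at x)) \<and> (\<forall>v. C_on k S (\<lambda>x. frechet_derivative f (at x) v))"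

definition smooth_on :: "'a::euclidean_space set \<Rightarrow> ('a \<Rightarrow> 'b::real_normed_vector) \<Rightarrow> bool" where
  "smooth_on S f \<longleftrightarrow> (\<forall>k. C_on k S f)"

definition consistent_flux :: "'a set \<Rightarrow> ('a \<Rightarrow> 'b) \<Rightarrow> ('a \<Rightarrow> 'a \<Rightarrow> 'b) \<Rightarrow> bool" where
  "consistent_flux U f fvol \<longleftrightarrow> (\<forall>v\<in>U. fvol v v = f v)"

definition symmetric_flux :: "'a set \<Rightarrow> ('a \<Rightarrow> 'a \<Rightarrow> 'b) \<Rightarrow> bool" where
  "symmetric_flux U fvol \<longleftrightarrow> (\<forall>v\<in>U. \<forall>w\<in>U. fvol v w = fvol w v)"

text \<open>
  One-dimensional nodal SBP operator on the element \<open>[a, b]\<close> with nodes \<open>x\<close>, mass matrix \<open>M\<close>,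
  derivative matrix \<open>D\<close> and restriction \<open>R\<close> of nodal values to the two boundary points (row 1
  is the left, row 2 the right end). Boundary points need not be nodes.
\<close>

definition exact_derivative :: "nat \<Rightarrow> ('m::finite \<Rightarrow> real) \<Rightarrow> real^'m^'m \<Rightarrow> bool" where
  "exact_derivative p x D \<longleftrightarrow>
     (\<forall>q :: real poly. degree q \<le> p \<longrightarrow>
        (\<forall>i. (\<Sum>k\<in>UNIV. D $ i $ k * poly q (x k)) = poly (pderiv q) (x i)))"

definition exact_restriction ::
    "nat \<Rightarrow> real \<Rightarrow> real \<Rightarrow> ('m::finite \<Rightarrow> real) \<Rightarrow> real^'m^2 \<Rightarrow> bool" where
  "exact_restriction p a b x R \<longleftrightarrow>
     (\<forall>q :: real poly. degree q \<le> p \<longrightarrow>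
        R *v (\<chi> k. poly q (x k)) = vector [poly q a, poly q b])"

definition boundary_matrix :: "real^2^2" where
  "boundary_matrix = vector [vector [-1, 0], vector [0, 1]]"

definition sbp_operator ::
    "nat \<Rightarrow> real \<Rightarrow> real \<Rightarrow> ('m::finite \<Rightarrow> real) \<Rightarrow> real^'m^'m \<Rightarrow> real^'m^'m \<Rightarrow> real^'m^2 \<Rightarrow> bool" where
  "sbp_operator p a b x M D R \<longleftrightarrow>
     a < b \<and> inj x \<and>
     transpose M = M \<and> (\<forall>v. v \<noteq> 0 \<longrightarrow> v \<bullet> (M *v v) > 0) \<and>
     exact_derivative p x D \<and> exact_restriction p a b x R \<and>
     M ** D + transpose D ** M = transpose R ** boundary_matrix ** R"

text \<open>
  Transport of a reference operator to the element obtained from \<open>[a, b]\<close> by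
  \<open>\<xi> \<mapsto> c + h \<xi>\<close>: the derivative matrix is divided by \<open>h\<close>, the mass matrix multiplied by \<open>h\<close>.
\<close>

lemma sbp_operator_scale:
  fixes M D :: "real^'m::finite^'m" and R :: "real^'m^2"
  assumes "sbp_operator p a b \<xi> M D R" and h: "h > 0"
  shows "sbp_operator p (c + h * a) (c + h * b) (\<lambda>i. c + h * \<xi> i)
           (h *\<^sub>R M) ((1 / h) *\<^sub>R D) R"
proof -
  have A: "a < b" "inj \<xi>" "transpose M = M" "\<And>v. v \<noteq> 0 \<Longrightarrow> v \<bullet> (M *v v) > 0"
    "exact_derivative p \<xi> D" "exact_restriction p a b \<xi> R"
    "M ** D + transpose D ** M = transpose R ** boundary_matrix ** R"
    using assms(1) by (auto simp: sbp_operator_def)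
  have poly_shift: "poly q (c + h * y) = poly (pcompose q [:c, h:]) y" for q y
    by (simp add: poly_pcompose algebra_simps)
  have deg: "degree (pcompose q [:c, h:]) \<le> p" if "degree q \<le> p" for q :: "real poly"
    using that h by (simp add: degree_pcompose)
  have der: "exact_derivative p (\<lambda>i. c + h * \<xi> i) ((1 / h) *\<^sub>R D)"
    unfolding exact_derivative_def
  proof (intro allI impI)
    fix q :: "real poly" and i :: 'm
    assume "degree q \<le> p"
    then have "(\<Sum>k\<in>UNIV. D $ i $ k * poly (pcompose q [:c, h:]) (\<xi> k))
        = poly (pderiv (pcompose q [:c, h:])) (\<xi> i)"
      using A(5) deg unfolding exact_derivative_def by blast
    also have "\<dots> = h * poly (pderiv q) (c + h * \<xi> i)"
      by (simp add: pderiv_pcompose pderiv_pCons poly_pcompose algebra_simps)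
    finally have e: "(\<Sum>k\<in>UNIV. D $ i $ k * poly q (c + h * \<xi> k)) = h * poly (pderiv q) (c + h * \<xi> i)"
      by (simp only: poly_shift)
    have "(\<Sum>k\<in>UNIV. ((1 / h) *\<^sub>R D) $ i $ k * poly q (c + h * \<xi> k))
        = (1 / h) * (\<Sum>k\<in>UNIV. D $ i $ k * poly q (c + h * \<xi> k))"
      by (simp add: sum_distrib_left mult.assoc sum_divide_distrib)
    with e h show "(\<Sum>k\<in>UNIV. ((1 / h) *\<^sub>R D) $ i $ k * poly q (c + h * \<xi> k))
        = poly (pderiv q) (c + h * \<xi> i)"
      by simp
  qed
  have res: "exact_restriction p (c + h * a) (c + h * b) (\<lambda>i. c + h * \<xi> i) R"
    using A(6) deg unfolding exact_restriction_def poly_shift by blast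
  have "transpose (h *\<^sub>R M) = h *\<^sub>R M"
    using A(3) by (simp add: transpose_def vec_eq_iff)
  moreover have "v \<bullet> ((h *\<^sub>R M) *v v) > 0" if "v \<noteq> 0" for v
    using A(4)[OF that] h by (simp add: scaleR_matrix_vector_assoc[symmetric])
  moreover have "(h *\<^sub>R M) ** ((1 / h) *\<^sub>R D) = M ** D"
    and "transpose ((1 / h) *\<^sub>R D) ** (h *\<^sub>R M) = transpose D ** M"
    using h by (simp_all add: vec_eq_iff matrix_matrix_mult_def transpose_def)
  moreover have "inj (\<lambda>i. c + h * \<xi> i)"
    using A(2) h by (auto simp: inj_def)
  ultimately show ?thesis
    using A(1,7) h der res by (simp add: sbp_operator_def)
qed

definition volume_terms ::
    "real^'m::finite^'m \<Rightarrow> ('a \<Rightarrow> 'a \<Rightarrow> 'b::real_vector) \<Rightarrow> ('m \<Rightarrow> 'a) \<Rightarrow> 'm \<Rightarrow> 'b" where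
  "volume_terms D fvol u i = (\<Sum>k\<in>UNIV. (2 * D $ i $ k) *\<^sub>R fvol (u i) (u k))"

end

theory Submission
  imports Defs
begin

text \<open>
  Put \<open>G (s, t) = fvol (u s) (u t)\<close>. With \<open>s = x\<^sub>i\<close> fixed, the volume terms are twice the
  discrete derivative of \<open>t \<mapsto> G (s, t)\<close>, so they approximate twice its derivative at \<open>t = s\<close>
  with the order of \<open>D\<close>. By symmetry both partial derivatives of \<open>G\<close> agree at \<open>(s, s)\<close>, so twice
  this partial derivative is the derivative of the diagonal \<open>G (s, s) = f (u s)\<close>. Since \<open>x\<^sub>i\<close>
  moves with \<open>h\<close>, the Taylor remainder has to be bounded uniformly in \<open>s\<close>, which compactness gives.
\<close>

section \<open>Closure properties of \<open>C_on\<close>\<close>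

text \<open>Openness of \<open>S\<close> makes the two functions agree near each point, so their
  derivatives agree too and the induction carries on to higher orders.\<close>

lemma C_on_cong:
  assumes "open S" "C_on k S f" "\<And>x. x \<in> S \<Longrightarrow> f x = g x"
  shows "C_on k S g"
  using assms(2,3)
proof (induction k arbitrary: f g)
  case 0
  then show ?case using continuous_on_cong[of S S f g] by simp
next
  case (Suc k)
  have *: "(g has_derivative frechet_derivative f (at x)) (at x)" if "x \<in> S" for x
  proof (rule has_derivative_transform_within_open[OF _ \<open>open S\<close> that])
    show "(f has_derivative frechet_derivative f (at x)) (at x)"
      using Suc.prems(1) that frechet_derivative_works by auto
  qed (use Suc.prems in auto)
  have eq: "frechet_derivative f (at x) v = frechet_derivative g (at x) v" if "x \<in> S" for x v
    using frechet_derivative_at[OF *[OF that]] by simp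
  have "C_on k S (\<lambda>x. frechet_derivative g (at x) v)" for v
    by (rule Suc.IH[OF _ eq]) (use Suc.prems(1) in auto)
  then show ?case
    using * by (auto simp: differentiable_def)
qed

text \<open>Uniqueness of the derivative lets an explicit formula \<open>f'\<close> stand in for the
  chosen \<open>frechet_derivative\<close>. Most closure proofs below supply such a formula and
  recurse on it.\<close>

lemma C_on_SucI:
  assumes "open S" "\<And>x. x \<in> S \<Longrightarrow> (f has_derivative f' x) (at x)"
    and "\<And>v. C_on k S (\<lambda>x. f' x v)"
  shows "C_on (Suc k) S f"
proof -
  have "f' x v = frechet_derivative f (at x) v" if "x \<in> S" for x v
    using frechet_derivative_at[OF assms(2)[OF that]] by simp
  then have "C_on k S (\<lambda>x. frechet_derivative f (at x) v)" for v
    by (rule C_on_cong[OF \<open>open S\<close> assms(3)])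
  then show ?thesis
    using assms(2) by (auto simp: differentiable_def)
qed

lemma C_on_SucD:
  assumes "C_on (Suc k) S f"
  shows "C_on k S f"
  using assms
proof (induction k arbitrary: f)
  case 0
  then show ?case
    by (auto intro!: continuous_at_imp_continuous_on differentiable_imp_continuous_within)
next
  case (Suc k)
  then show ?case by simp
qed

lemma C_on_has_derivative:
  assumes "C_on (Suc k) S f" "x \<in> S"
  shows "(f has_derivative frechet_derivative f (at x)) (at x)"
  using assms frechet_derivative_works by auto

lemma C_on_const: "open S \<Longrightarrow> C_on k S (\<lambda>x. c)"
  by (induction k arbitrary: c) (auto simp: frechet_derivative_const)

lemma C_on_bounded_linear_comp:
  assumes "open S" "bounded_linear L" "C_on k S f"
  shows "C_on k S (\<lambda>x. L (f x))"
  using assms(3)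
proof (induction k arbitrary: f)
  case 0
  then show ?case using bounded_linear.continuous_on[OF assms(2)] by simp
next
  case (Suc k)
  show ?case
  proof (rule C_on_SucI[OF \<open>open S\<close>])
    fix x assume "x \<in> S"
    show "((\<lambda>x. L (f x)) has_derivative (\<lambda>v. L (frechet_derivative f (at x) v))) (at x)"
      by (rule bounded_linear.has_derivative[OF assms(2) C_on_has_derivative[OF Suc.prems \<open>x \<in> S\<close>]])
  qed (use Suc in auto)
qed

lemma C_on_add:
  assumes "open S" "C_on k S f" "C_on k S g"
  shows "C_on k S (\<lambda>x. f x + g x)"
  using assms(2,3)
proof (induction k arbitrary: f g)
  case 0
  then show ?case by (simp add: continuous_on_add)
next
  case (Suc k)
  show ?case
  proof (rule C_on_SucI[OF \<open>open S\<close>])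
    fix x assume "x \<in> S"
    show "((\<lambda>x. f x + g x) has_derivative
        (\<lambda>v. frechet_derivative f (at x) v + frechet_derivative g (at x) v)) (at x)"
      by (intro has_derivative_add C_on_has_derivative[OF Suc.prems(1) \<open>x \<in> S\<close>]
          C_on_has_derivative[OF Suc.prems(2) \<open>x \<in> S\<close>])
  qed (use Suc in auto)
qed

lemma C_on_sum:
  assumes "open S" "\<And>j. j \<in> A \<Longrightarrow> C_on k S (f j)"
  shows "C_on k S (\<lambda>x. \<Sum>j\<in>A. f j x)"
  using assms(2)
  by (induction A rule: infinite_finite_induct) (auto simp: C_on_const C_on_add assms(1))

lemma C_on_scaleR:
  assumes "open S" "C_on k S f" "C_on k S g"
  shows "C_on k S (\<lambda>x. f x *\<^sub>R g x)"
  using assms(2,3)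
proof (induction k arbitrary: f g)
  case 0
  then show ?case by (simp add: continuous_on_scaleR)
next
  case (Suc k)
  show ?case
  proof (rule C_on_SucI[OF \<open>open S\<close>])
    fix x assume "x \<in> S"
    show "((\<lambda>x. f x *\<^sub>R g x) has_derivative
        (\<lambda>v. f x *\<^sub>R frechet_derivative g (at x) v + frechet_derivative f (at x) v *\<^sub>R g x)) (at x)"
      by (intro has_derivative_scaleR C_on_has_derivative[OF Suc.prems(1) \<open>x \<in> S\<close>]
          C_on_has_derivative[OF Suc.prems(2) \<open>x \<in> S\<close>])
  next
    fix v
    show "C_on k S (\<lambda>x. f x *\<^sub>R frechet_derivative g (at x) v
        + frechet_derivative f (at x) v *\<^sub>R g x)"
      \<comment> \<open>The product rule leaves \<open>f\<close> and \<open>g\<close>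
        undifferentiated in one factor each, so their regularity has to be lowered to level
        \<open>k\<close>.\<close>
      by (intro C_on_add \<open>open S\<close> Suc.IH C_on_SucD[OF Suc.prems(1)] C_on_SucD[OF Suc.prems(2)])
        (use Suc.prems in auto)
  qed
qed

text \<open>The chain rule differentiates \<open>f\<close> in a direction that moves with
  \<open>x\<close>, while \<open>C_on\<close> controls fixed directions only. Expanding the
  direction in \<open>Basis\<close> yields products of coefficients with derivatives of
  \<open>f\<close> in fixed directions. The induction replaces \<open>f\<close> by these derivatives
  and keeps \<open>g\<close>.\<close>

lemma C_on_compose:
  fixes g :: "'a::euclidean_space \<Rightarrow> 'b::euclidean_space" and f :: "'b \<Rightarrow> 'c::real_normed_vector"
  assumes "open S" "C_on k S g" "C_on k T f" "g ` S \<subseteq> T"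
  shows "C_on k S (\<lambda>x. f (g x))"
  using assms(2,3)
proof (induction k arbitrary: f)
  case 0
  then show ?case using continuous_on_compose2[of T f S g] assms(4) by simp
next
  case (Suc k)
  let ?f' = "\<lambda>y. frechet_derivative f (at y)" and ?g' = "\<lambda>x. frechet_derivative g (at x)"
  show ?case
  proof (rule C_on_SucI[OF \<open>open S\<close>])
    fix x assume "x \<in> S"
    then have f: "(f has_derivative ?f' (g x)) (at (g x))"
      using C_on_has_derivative[OF Suc.prems(2)] assms(4) by auto
    have lin: "linear (?f' (g x))" using f has_derivative_linear by blast
    have eq: "?f' (g x) (?g' x v) = (\<Sum>b\<in>Basis. (?g' x v \<bullet> b) *\<^sub>R ?f' (g x) b)" for v
      by (subst euclidean_representation[of "?g' x v", symmetric])
        (simp only: linear_sum[OF lin] linear_scale[OF lin])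
    show "((\<lambda>x. f (g x)) has_derivative
        (\<lambda>v. \<Sum>b\<in>Basis. (?g' x v \<bullet> b) *\<^sub>R ?f' (g x) b)) (at x)"
      using has_derivative_compose[OF C_on_has_derivative[OF Suc.prems(1) \<open>x \<in> S\<close>] f]
      unfolding eq .
  next
    fix v
    have 1: "C_on k S (\<lambda>x. ?g' x v \<bullet> b)" for b
      using Suc.prems(1) by (intro C_on_bounded_linear_comp[OF \<open>open S\<close> bounded_linear_inner_left]) auto
    have 2: "C_on k S (\<lambda>x. ?f' (g x) b)" for b
      by (rule Suc.IH) (use Suc.prems C_on_SucD in auto)
    show "C_on k S (\<lambda>x. \<Sum>b\<in>Basis. (?g' x v \<bullet> b) *\<^sub>R ?f' (g x) b)"
      by (intro C_on_sum C_on_scaleR \<open>open S\<close> 1 2)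
  qed
qed

lemma C_on_bounded_linear:
  assumes "open S" "bounded_linear L"
  shows "C_on k S L"
proof (cases k)
  case 0
  then show ?thesis using assms(2) by (simp add: linear_continuous_on)
next
  case (Suc m)
  show ?thesis unfolding Suc
  proof (rule C_on_SucI[OF \<open>open S\<close>])
    show "(L has_derivative L) (at x)" for x
      using assms(2) bounded_linear_imp_has_derivative by blast
  qed (rule C_on_const[OF \<open>open S\<close>])
qed

lemma C_on_Pair:
  assumes "open S" "C_on k S f" "C_on k S g"
  shows "C_on k S (\<lambda>x. (f x, g x))"
proof -
  have "bounded_linear (\<lambda>x. (x, 0))" "bounded_linear (\<lambda>x. (0, x))"
    by (auto intro!: bounded_linear_Pair bounded_linear_ident bounded_linear_zero)
  from C_on_add[OF assms(1) C_on_bounded_linear_comp[OF assms(1) this(1) assms(2)]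
      C_on_bounded_linear_comp[OF assms(1) this(2) assms(3)]]
  show ?thesis by simp
qed

section \<open>Taylor expansion with a uniform remainder\<close>

lemma norm_Taylor_le:
  fixes g :: "nat \<Rightarrow> real \<Rightarrow> 'a::real_inner"
  assumes "convex S"
    and g: "\<And>j x. x \<in> S \<Longrightarrow> j \<le> n \<Longrightarrow> (g j has_vector_derivative g (Suc j) x) (at x within S)"
    and B: "\<And>x. x \<in> S \<Longrightarrow> norm (g (Suc n) x) \<le> B"
    and "s \<in> S" "t \<in> S"
  shows "norm (g 0 t - (\<Sum>j\<le>n. ((t - s) ^ j / fact j) *\<^sub>R g j s)) \<le> B * \<bar>t - s\<bar> ^ Suc n / fact n"
proof -
  define y where "y = g 0 t - (\<Sum>j\<le>n. ((t - s) ^ j / fact j) *\<^sub>R g j s)"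
  \<comment> \<open>Testing against the direction of the remainder reduces the bound to the scalar case.\<close>
  define e where "e = sgn y"
  \<comment> \<open>For \<open>y = 0\<close> the direction \<open>e\<close> is 0, hence only an
    inequality for its norm.\<close>
  have e: "norm e \<le> 1" "y \<bullet> e = norm y"
    by (cases "y = 0"; simp add: e_def norm_sgn sgn_div_norm dot_square_norm power2_eq_square)+
  have 1: "((\<lambda>x. g j x \<bullet> e) has_field_derivative g (Suc j) x \<bullet> e) (at x within S)"
    if "x \<in> S" "j \<le> n" for j x
    unfolding has_real_derivative_iff_has_vector_derivative
    by (rule bounded_linear.has_vector_derivative[OF bounded_linear_inner_left g[OF that]])
  have 2: "norm (g (Suc n) x \<bullet> e) \<le> B" if "x \<in> S" for x
  proof -
    have "norm (g (Suc n) x \<bullet> e) \<le> norm (g (Suc n) x) * norm e"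
      by (simp add: Cauchy_Schwarz_ineq2)
    also have "\<dots> \<le> norm (g (Suc n) x) * 1" by (intro mult_left_mono e) auto
    finally show ?thesis using B[OF that] by simp
  qed
  have "norm (g 0 t \<bullet> e - (\<Sum>j\<le>n. (g j s \<bullet> e) * (t - s) ^ j / fact j))
      \<le> B * norm (t - s) ^ Suc n / fact n"
    by (rule field_Taylor[where f = "\<lambda>j x. g j x \<bullet> e", OF assms(1) 1 2 assms(4,5)])
  moreover have "g 0 t \<bullet> e - (\<Sum>j\<le>n. (g j s \<bullet> e) * (t - s) ^ j / fact j) = y \<bullet> e"
    by (simp add: y_def inner_diff_left inner_sum_left mult.commute)
  ultimately show ?thesis by (simp add: e y_def[symmetric])
qed


text \<open>The coefficient \<open>c j s\<close> is the \<open>j\<close>-th partial derivative in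
  the second variable at \<open>(s, s)\<close>. The same \<open>B\<close> also bounds
  \<open>c (Suc n)\<close>, which matters for \<open>n = 0\<close>, where the Taylor sum does not
  contain \<open>c 1\<close>.\<close>

lemma uniform_Taylor_partial:
  fixes G :: "real \<times> real \<Rightarrow> 'a::real_inner"
  assumes "open I" "x0 \<in> I" and smooth: "smooth_on (I \<times> I) G"
  obtains \<delta> c B where "\<delta> > 0" "cball x0 \<delta> \<subseteq> I"
    and "\<And>s. s \<in> cball x0 \<delta> \<Longrightarrow> ((\<lambda>t. G (s, t)) has_vector_derivative c 1 s) (at s)"
    and "\<And>s. s \<in> cball x0 \<delta> \<Longrightarrow> norm (c (Suc n) s) \<le> B"
    and "\<And>s t. s \<in> cball x0 \<delta> \<Longrightarrow> t \<in> cball x0 \<delta> \<Longrightarrow>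
      norm (G (s, t) - (\<Sum>j\<le>n. ((t - s) ^ j / fact j) *\<^sub>R c j s)) \<le> B * \<bar>t - s\<bar> ^ Suc n"
proof -
  \<comment> \<open>The iterated partial derivatives are kept as functions of both variables: their
    joint continuity makes the bound on a compact square uniform in \<open>s\<close> and
    \<open>t\<close>.\<close>
  define P where "P j = ((\<lambda>F z. frechet_derivative F (at z) (0, 1)) ^^ j) G" for j
  have P0: "P 0 = G" and PS: "P (Suc j) = (\<lambda>z. frechet_derivative (P j) (at z) (0, 1))" for j
    by (auto simp: P_def)
  have C: "C_on k (I \<times> I) (P j)" for k j
  proof (induction j arbitrary: k)
    case 0
    then show ?case using smooth by (simp add: P0 smooth_on_def)
  next
    case (Suc j)
    show ?case using Suc[of "Suc k"] by (simp add: PS)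
  qed
  have dP: "((\<lambda>t. P j (s, t)) has_vector_derivative P (Suc j) (s, t)) (at t)"
    if "s \<in> I" "t \<in> I" for j s t
  proof -
    have "(P j has_derivative frechet_derivative (P j) (at (s, t))) (at (s, t))"
      using C_on_has_derivative[OF C[of "Suc 0"]] that by simp
    moreover have "((\<lambda>t. (s, t)) has_vector_derivative (0, 1)) (at t)"
      by (auto intro!: derivative_eq_intros)
    ultimately show ?thesis
      using vector_derivative_diff_chain_within[of "\<lambda>t. (s, t)" "(0, 1)" t UNIV "P j"]
      by (auto simp: PS o_def intro: has_derivative_at_withinI)
  qed
  obtain \<delta> where \<delta>: "\<delta> > 0" "cball x0 \<delta> \<subseteq> I"
    using assms open_contains_cball by blast
  have "compact (P (Suc n) ` (cball x0 \<delta> \<times> cball x0 \<delta>))"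
  proof (rule compact_continuous_image)
    show "continuous_on (cball x0 \<delta> \<times> cball x0 \<delta>) (P (Suc n))"
      using C[of 0 "Suc n"] \<delta>(2) by (auto elim!: continuous_on_subset)
  qed (intro compact_Times compact_cball)
  then obtain B where "\<forall>y \<in> P (Suc n) ` (cball x0 \<delta> \<times> cball x0 \<delta>). norm y \<le> B"
    using compact_imp_bounded bounded_iff by blast
  then have B: "norm (P (Suc n) (s, t)) \<le> B" if "s \<in> cball x0 \<delta>" "t \<in> cball x0 \<delta>" for s t
    using that by blast
  \<comment> \<open>The sign of \<open>B\<close> is needed to drop the denominator
    \<open>fact n\<close> below.\<close>
  have "0 \<le> B"
    using B[of x0 x0] \<delta>(1) norm_ge_zero[of "P (Suc n) (x0, x0)"] by (simp del: norm_ge_zero)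
  show ?thesis
  proof
    fix s assume s: "s \<in> cball x0 \<delta>"
    show "((\<lambda>t. G (s, t)) has_vector_derivative P 1 (s, s)) (at s)"
      using dP[of s s 0] s \<delta>(2) by (auto simp: P0)
    show "norm (P (Suc n) (s, s)) \<le> B" using B s by blast
    fix t assume t: "t \<in> cball x0 \<delta>"
    have "norm (P 0 (s, t) - (\<Sum>j\<le>n. ((t - s) ^ j / fact j) *\<^sub>R P j (s, s)))
        \<le> B * \<bar>t - s\<bar> ^ Suc n / fact n"
      by (rule norm_Taylor_le[where g = "\<lambda>j t. P j (s, t)" and S = "cball x0 \<delta>"])
        (use s t \<delta>(2) B in \<open>auto intro!: has_vector_derivative_at_within[OF dP]\<close>)
    also have "\<dots> \<le> B * \<bar>t - s\<bar> ^ Suc n"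
      using \<open>0 \<le> B\<close> mult_right_mono[OF fact_ge_1[of n], of "B * \<bar>t - s\<bar> ^ Suc n"]
      by (simp add: divide_le_eq mult.commute del: power_Suc)
    finally show "norm (G (s, t) - (\<Sum>j\<le>n. ((t - s) ^ j / fact j) *\<^sub>R P j (s, s)))
        \<le> B * \<bar>t - s\<bar> ^ Suc n"
      by (simp add: P0)
  qed (use \<delta> in auto)
qed

section \<open>Derivative along the diagonal\<close>

text \<open>The curves \<open>(s, t)\<close>, \<open>(t, s)\<close> and \<open>(t, t)\<close> pass
  through \<open>(s, s)\<close> with velocities \<open>(0, 1)\<close>, \<open>(1, 0)\<close> and
  their sum \<open>(1, 1)\<close>. Symmetry gives the first two the same derivative
  \<open>d\<close>, and linearity of the total derivative doubles it on the diagonal.\<close>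

lemma symmetric_diagonal_derivative:
  fixes G :: "real \<times> real \<Rightarrow> 'a::real_normed_vector"
  assumes "G differentiable at (s, s)" "open I" "s \<in> I"
    and sym: "\<And>t. t \<in> I \<Longrightarrow> G (t, s) = G (s, t)"
    and d: "((\<lambda>t. G (s, t)) has_vector_derivative d) (at s)"
  shows "((\<lambda>t. G (t, t)) has_vector_derivative 2 *\<^sub>R d) (at s)"
proof -
  obtain G' where G': "(G has_derivative G') (at (s, s))"
    using assms(1) by (auto simp: differentiable_def)
  have chain: "((\<lambda>t. G (\<gamma> t)) has_vector_derivative G' v) (at s)"
    if "(\<gamma> has_vector_derivative v) (at s)" "\<gamma> s = (s, s)" for \<gamma> v
    using vector_derivative_diff_chain_within[of \<gamma> v s UNIV G G'] G' that
    by (auto simp: o_def intro: has_derivative_at_withinI)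
  have "((\<lambda>t. G (s, t)) has_vector_derivative G' (0, 1)) (at s)"
    by (rule chain) (auto intro!: derivative_eq_intros)
  then have 1: "G' (0, 1) = d"
    using d vector_derivative_unique_at by blast
  have "((\<lambda>t. G (t, s)) has_vector_derivative G' (1, 0)) (at s)"
    by (rule chain) (auto intro!: derivative_eq_intros)
  then have "((\<lambda>t. G (s, t)) has_vector_derivative G' (1, 0)) (at s)"
    by (rule has_vector_derivative_transform_within_open[OF _ assms(2,3)]) (rule sym)
  then have 2: "G' (1, 0) = d"
    using d vector_derivative_unique_at by blast
  have "G' ((1, 0) + (0, 1)) = G' (1, 0) + G' (0, 1)"
    using G' has_derivative_linear linear_add by blast
  then have "G' (1, 1) = 2 *\<^sub>R d"
    by (simp add: 1 2 scaleR_2)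
  moreover have "((\<lambda>t. G (t, t)) has_vector_derivative G' (1, 1)) (at s)"
    by (rule chain) (auto intro!: derivative_eq_intros)
  ultimately show ?thesis by simp
qed

section \<open>Error of the derivative matrix\<close>

text \<open>Exactness is applied to monomials centred at the node \<open>x i\<close> itself, where
  the derivative vanishes unless the degree is 1. Applied to a Taylor polynomial, the matrix thus
  picks out the linear coefficient.\<close>

lemma exact_derivative_moment:
  assumes "exact_derivative p x D" "j \<le> p"
  shows "(\<Sum>k\<in>UNIV. D $ i $ k * (x k - x i) ^ j) = (if j = 1 then 1 else 0)"
proof -
  let ?q = "[:- x i, 1:] ^ j :: real poly"
  have "degree ?q \<le> p" using assms(2) by (simp add: degree_linear_power)
  then have "(\<Sum>k\<in>UNIV. D $ i $ k * poly ?q (x k)) = poly (pderiv ?q) (x i)"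
    using assms(1) unfolding exact_derivative_def by blast
  then show ?thesis
    by (cases "j = 0") (auto simp: pderiv_power pderiv_pCons power_0_left)
qed

text \<open>
  For \<open>p = 0\<close> the operator need not differentiate linear functions, and the whole derivative
  \<open>c 1\<close> counts as error: this is the last summand.
\<close>

lemma derivative_matrix_error:
  fixes g :: "'m::finite \<Rightarrow> 'a::real_normed_vector"
  assumes D: "exact_derivative p x D"
    and Taylor: "\<And>k. norm (g k - (\<Sum>j\<le>p. ((x k - x i) ^ j / fact j) *\<^sub>R c j))
        \<le> B * \<bar>x k - x i\<bar> ^ Suc p"
    and B: "norm (c (Suc p)) \<le> B"
  shows "norm ((\<Sum>k\<in>UNIV. D $ i $ k *\<^sub>R g k) - c 1)
    \<le> B * ((\<Sum>k\<in>UNIV. \<bar>D $ i $ k\<bar> * \<bar>x k - x i\<bar> ^ Suc p) + (if p = 0 then 1 else 0))"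
proof -
  define T where "T k = (\<Sum>j\<le>p. ((x k - x i) ^ j / fact j) *\<^sub>R c j)" for k
  have "(\<Sum>k\<in>UNIV. D $ i $ k *\<^sub>R T k)
      = (\<Sum>k\<in>UNIV. \<Sum>j\<le>p. (D $ i $ k * (x k - x i) ^ j / fact j) *\<^sub>R c j)"
    by (simp add: T_def scaleR_sum_right)
  also have "\<dots> = (\<Sum>j\<le>p. ((\<Sum>k\<in>UNIV. D $ i $ k * (x k - x i) ^ j) / fact j) *\<^sub>R c j)"
    by (subst sum.swap) (simp add: scaleR_sum_left sum_divide_distrib)
  also have "\<dots> = (\<Sum>j\<le>p. if j = 1 then c 1 else 0)"
    by (intro sum.cong refl) (auto simp: exact_derivative_moment[OF D])
  also have "\<dots> = (if p = 0 then 0 else c 1)"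
    by (simp add: sum.delta)
  finally have DT: "(\<Sum>k\<in>UNIV. D $ i $ k *\<^sub>R T k) = (if p = 0 then 0 else c 1)" .
  \<comment> \<open>For positive \<open>p\<close> only the Taylor remainders survive. For
    \<open>p = 0\<close> the uncancelled \<open>c 1\<close> is \<open>c (Suc p)\<close>, which
    \<open>B\<close> bounds.\<close>
  have "(\<Sum>k\<in>UNIV. D $ i $ k *\<^sub>R g k) - c 1
      = (\<Sum>k\<in>UNIV. D $ i $ k *\<^sub>R (g k - T k)) + (if p = 0 then - c (Suc p) else 0)"
    using DT by (auto simp: scaleR_diff_right sum_subtractf)
  also have "norm \<dots> \<le> (\<Sum>k\<in>UNIV. \<bar>D $ i $ k\<bar> * (B * \<bar>x k - x i\<bar> ^ Suc p))
      + (if p = 0 then B else 0)"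
    using B Taylor unfolding T_def[symmetric]
    by (intro norm_triangle_mono sum_norm_le) (auto simp del: power_Suc intro!: mult_left_mono)
  finally show ?thesis
    by (cases "p = 0") (simp_all add: distrib_left sum_distrib_left mult.left_commute del: power_Suc)
qed

section \<open>Order of the volume terms on shrinking elements\<close>

theorem theorem3p1:
  fixes U :: "(real^'n) set"
    and f :: "real^'n \<Rightarrow> real^'n"
    and fvol :: "real^'n \<Rightarrow> real^'n \<Rightarrow> real^'n"
    and p :: nat
    and a b :: real
    and \<xi> :: "'m::finite \<Rightarrow> real"
    and M D :: "real^'m^'m"
    and R :: "real^'m^2"
    and I :: "real set"
    and u :: "real \<Rightarrow> real^'n"
    and xc :: real
    and i :: 'm
  assumes "open U"
    and "smooth_on U f"
    and "sbp_operator p a b \<xi> M D R"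
    and "smooth_on (U \<times> U) (\<lambda>(v, w). fvol v w)"
    and "consistent_flux U f fvol"
    and "symmetric_flux U fvol"
    and "open I" and "xc \<in> I"
    and "smooth_on I u" and "u ` I \<subseteq> U"
  shows "(\<lambda>h. norm (volume_terms ((1 / h) *\<^sub>R D) fvol (\<lambda>k. u (xc + h * \<xi> k)) i
             - vector_derivative (\<lambda>x. f (u x)) (at (xc + h * \<xi> i))))
         \<in> O[at_right 0](\<lambda>h. h ^ p)"
proof -
  define G where "G = (\<lambda>(s, t). fvol (u s) (u t))"
  have G: "G (s, t) = fvol (u s) (u t)" for s t by (simp add: G_def)
  have oI: "open (I \<times> I)" by (intro open_Times assms)
  have smooth: "C_on k (I \<times> I) G" for k
  proof -
    have u: "C_on k I u" and F: "C_on k (U \<times> U) (\<lambda>(v, w). fvol v w)"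
      using assms(4,9) by (auto simp: smooth_on_def)
    have "C_on k (I \<times> I) (\<lambda>z. (u (fst z), u (snd z)))"
      by (intro C_on_Pair oI C_on_compose[OF oI _ u] C_on_bounded_linear
          bounded_linear_fst bounded_linear_snd) auto
    from C_on_compose[OF oI this F] show ?thesis
      using assms(10) by (auto simp: G_def case_prod_unfold image_subset_iff)
  qed
  then have G_smooth: "smooth_on (I \<times> I) G" by (simp add: smooth_on_def)
  obtain \<delta> c B
    where \<delta>: "\<delta> > 0" "cball xc \<delta> \<subseteq> I"
      and c1: "\<And>s. s \<in> cball xc \<delta> \<Longrightarrow> ((\<lambda>t. G (s, t)) has_vector_derivative c 1 s) (at s)"
      and B: "\<And>s. s \<in> cball xc \<delta> \<Longrightarrow> norm (c (Suc p) s) \<le> B"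
      and Taylor: "\<And>s t. s \<in> cball xc \<delta> \<Longrightarrow> t \<in> cball xc \<delta> \<Longrightarrow>
        norm (G (s, t) - (\<Sum>j\<le>p. ((t - s) ^ j / fact j) *\<^sub>R c j s)) \<le> B * \<bar>t - s\<bar> ^ Suc p"
  proof -
    show thesis
      by (rule uniform_Taylor_partial[OF assms(7,8) G_smooth, of p]) (fact that)
  qed
  have deriv: "vector_derivative (\<lambda>x. f (u x)) (at s) = 2 *\<^sub>R c 1 s" if "s \<in> cball xc \<delta>" for s
  proof -
    from that \<delta> have "s \<in> I" by auto
    have "G differentiable at (s, s)"
      using C_on_has_derivative[OF smooth[of "Suc 0"]] \<open>s \<in> I\<close> by (auto simp: differentiable_def)
    moreover have "G (t, s) = G (s, t)" if "t \<in> I" for t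
      using assms(6,10) that \<open>s \<in> I\<close> by (auto simp: G symmetric_flux_def)
    ultimately have "((\<lambda>t. G (t, t)) has_vector_derivative 2 *\<^sub>R c 1 s) (at s)"
      using symmetric_diagonal_derivative assms(7) \<open>s \<in> I\<close> c1[OF that] by blast
    then have "((\<lambda>x. f (u x)) has_vector_derivative 2 *\<^sub>R c 1 s) (at s)"
      by (rule has_vector_derivative_transform_within_open[OF _ assms(7) \<open>s \<in> I\<close>])
        (use assms(5,10) in \<open>auto simp: G consistent_flux_def\<close>)
    then show ?thesis by (rule vector_derivative_at)
  qed
  \<comment> \<open>\<open>K\<close> is the error factor of \<open>derivative_matrix_error\<close>
    on the reference element. Scaling gives \<open>1 / h\<close> from the matrix and
    \<open>h ^ Suc p\<close> from the node distances, leaving \<open>h ^ p\<close>; the extra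
    summand fits because \<open>h ^ 0 = 1\<close>.\<close>
  define K where "K = (\<Sum>k\<in>UNIV. \<bar>D $ i $ k\<bar> * \<bar>\<xi> k - \<xi> i\<bar> ^ Suc p) + (if p = 0 then 1 else 0)"
  \<comment> \<open>\<open>L\<close> dominates all reference nodes, so
    \<open>h < \<delta> / L\<close> keeps every node in the ball. The added 1 makes \<open>L\<close>
    positive even if the only node is 0.\<close>
  define L where "L = 1 + (\<Sum>k\<in>UNIV. \<bar>\<xi> k\<bar>)"
  have L: "\<bar>\<xi> k\<bar> \<le> L" for k
    unfolding L_def using member_le_sum[of k UNIV "\<lambda>k. \<bar>\<xi> k\<bar>"] by simp
  have "L > 0"
    unfolding L_def by (intro add_pos_nonneg sum_nonneg) auto
  have bound: "norm (volume_terms ((1 / h) *\<^sub>R D) fvol (\<lambda>k. u (xc + h * \<xi> k)) i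
      - vector_derivative (\<lambda>x. f (u x)) (at (xc + h * \<xi> i))) \<le> 2 * (B * K) * h ^ p"
    if h: "0 < h" "h < \<delta> / L" for h
  proof -
    define x where "x k = xc + h * \<xi> k" for k
    define D' where "D' = (1 / h) *\<^sub>R D"
    have x: "x k \<in> cball xc \<delta>" for k
    proof -
      have "\<bar>h * \<xi> k\<bar> \<le> h * L" using h(1) L by (simp add: abs_mult)
      also have "\<dots> \<le> \<delta>" using h \<open>L > 0\<close> by (simp add: pos_less_divide_eq)
      finally show ?thesis by (simp add: x_def dist_norm)
    qed
    have D': "exact_derivative p x D'"
      using sbp_operator_scale[OF assms(3) h(1)] unfolding sbp_operator_def x_def D'_def by blast
    have "\<bar>D' $ i $ k\<bar> * \<bar>x k - x i\<bar> ^ Suc p = (\<bar>D $ i $ k\<bar> * \<bar>\<xi> k - \<xi> i\<bar> ^ Suc p) * h ^ p" for k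
    proof -
      have "x k - x i = h * (\<xi> k - \<xi> i)" by (simp add: x_def algebra_simps)
      then show ?thesis
        using h(1) by (simp add: D'_def abs_mult power_mult_distrib)
    qed
    then have K: "(\<Sum>k\<in>UNIV. \<bar>D' $ i $ k\<bar> * \<bar>x k - x i\<bar> ^ Suc p) + (if p = 0 then 1 else 0) = K * h ^ p"
      by (simp add: K_def distrib_right sum_distrib_right del: power_Suc)
    \<comment> \<open>The factor 2 in the volume terms matches the 2 from the diagonal derivative,
      so the error is exactly twice that of \<open>D'\<close> applied to \<open>G\<close> with its
      first argument frozen at \<open>x i\<close>.\<close>
    have "volume_terms D' fvol (\<lambda>k. u (x k)) i - vector_derivative (\<lambda>x. f (u x)) (at (x i))
        = 2 *\<^sub>R ((\<Sum>k\<in>UNIV. D' $ i $ k *\<^sub>R G (x i, x k)) - c 1 (x i))"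
      by (simp add: volume_terms_def deriv[OF x] G scaleR_diff_right scaleR_sum_right)
    also have "norm \<dots> \<le> 2 * (B * (K * h ^ p))"
      using derivative_matrix_error[OF D' Taylor[OF x x] B[OF x], of i] unfolding K by simp
    finally show ?thesis by (simp add: x_def D'_def mult.assoc)
  qed
  show ?thesis
  proof (rule bigoI)
    show "\<forall>\<^sub>F h in at_right 0. norm (norm (volume_terms ((1 / h) *\<^sub>R D) fvol (\<lambda>k. u (xc + h * \<xi> k)) i
        - vector_derivative (\<lambda>x. f (u x)) (at (xc + h * \<xi> i)))) \<le> 2 * (B * K) * norm (h ^ p)"
    proof (rule eventually_mono)
      show "\<forall>\<^sub>F h in at_right 0. h \<in> {0<..<\<delta> / L}"
        using \<delta>(1) \<open>L > 0\<close> by (intro eventually_at_right_real) simp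
    qed (use bound in \<open>simp add: power_abs\<close>)
  qed
qed

end
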